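(* Let $\mathcal{A}$ be a finite abelian group, $D\geq 1$ and $\mathbb{M}=\mathbb{Z}^D$. If $\Phi:\mathcal{A}^{\mathbb{M}}\to\mathcal{A}^{\mathbb{M}}$ is a dispersive linear cellular automaton and $\mu$ is a dispersion mixing Borel probability measure on $\mathcal{A}^{\mathbb{M}}$, then $\Phi$ asymptotically randomizes $\mu$.
   Context: $\mathcal{A}$ is discrete and $\mathcal{A}^{\mathbb{M}}$ has the product topology. For $v\in\mathbb{M}$, $\sigma^v$ is the shift $\sigma^v(\mathbf{a})_m=a_{m-v}$. A linear cellular automaton (LCA) is a map $\Phi(\mathbf{a})=\sum_{f\in\mathbb{F}}\varphi_f\cdot\sigma^f(\mathbf{a})$ with $\mathbb{F}\subset\mathbb{M}$ finite, $\#\mathbb{F}\ge2$, and nonzero coefficients $\varphi_f\in\mathbb{Z}$. $\Phi$ asymptotically randomizes $\mu$ if there is $\mathbb{J}\subset\mathbb{N}$ of Cesàro density one, i.e. $\lim_{N\to\infty}\frac1N\#(\mathbb{J}\cap[0,N))=1$, such that $\Phi^j\mu$ converges weak* to $\eta$ as $j\to\infty$ in $\mathbb{J}$, where $\Phi^j\mu$ is the pushforward and $\eta$ is the uniform Bernoulli (Haar) measure on $\mathcal{A}^{\mathbb{M}}$. A character of $\mathcal{A}^{\mathbb{M}}$ is a continuous homomorphism into the circle group; each has the form $\boldsymbol\chi(\mathbf{a})=\prod_{k\in\mathbb{K}}\chi_k(a_k)$ with $\mathbb{K}\subset\mathbb{M}$ finite and each $\chi_k$ a nontrivial character of $\mathcal{A}$;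 call $\mathbb{K}$ its support. Write $|m|=|m_1|+\cdots+|m_D|$ for $m\in\mathbb{M}$. For $S>0$, two characters with supports $\mathbb{K},\mathbb{X}$ are $S$-separated if $|k-x|\ge S$ for all $k\in\mathbb{K}$, $x\in\mathbb{X}$. For a nontrivial character $\boldsymbol\chi$, $\mathrm{rank}_S(\boldsymbol\chi)$ is the maximal $R$ such that $\boldsymbol\chi=\boldsymbol\chi_1\cdots\boldsymbol\chi_R$ for some mutually $S$-separated nontrivial characters $\boldsymbol\chi_1,\dots,\boldsymbol\chi_R$; for the trivial character put $\mathrm{rank}_S=0$. $\mu$ is dispersion mixing if for every $\epsilon>0$ there exist $S,R>0$ such that every character $\boldsymbol\chi$ with $\mathrm{rank}_S(\boldsymbol\chi)>R$ satisfies $\left|\int\boldsymbol\chi\,d\mu\right|<\epsilon$. $\Phi$ is dispersive if for every $S>0$ and every nontrivial character $\boldsymbol\chi$ of $\mathcal{A}^{\mathbb{M}}$ there is a subset $\mathbb{J}\subset\mathbb{N}$ of Cesàro density one such that $\mathrm{rank}_S(\boldsymbol\chi\circ\Phi^j)\to\infty$ as $j\to\infty$ in $\mathbb{J}$. *)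

theory Defs
  imports "HOL-Probability.Probability" "HOL-Library.Function_Algebras"
begin

class finite_discrete_ab_group = finite + ab_group_add + discrete_topology

instance finite_discrete_ab_group \<subseteq> second_countable_topology
proof
  have "open = generate_topology (range (\<lambda>x::'a. {x}))"
  proof
    fix U :: "'a set"
    have "generate_topology (range (\<lambda>x::'a. {x})) (\<Union>x\<in>U. {x})"
      by (intro generate_topology_Union generate_topology.Basis) auto
    then show "open U = generate_topology (range (\<lambda>x::'a. {x})) U"
      by (simp add: Topological_Spaces.open_discrete)
  qed
  then show "\<exists>B::'a set set. countable B \<and> open = generate_topology B"
    by (intro exI[of _ "range (\<lambda>x::'a. {x})"]) (auto simp: countable_finite)
qed

text \<open>
  The lattice \<open>\<int>\<^sup>D\<close> is the type \<open>int ^ 'd\<close>, with \<open>D = CARD('d) \<ge> 1\<close>. Configurations carry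
  the library's product topology on functions and the pointwise group structure of
  \<open>Function_Algebras\<close>.
\<close>

type_synonym ('d, 'a) config = "int ^ 'd \<Rightarrow> 'a"

definition shift :: "int ^ 'd \<Rightarrow> ('d::finite, 'a) config \<Rightarrow> ('d, 'a) config" where
  "shift v a = (\<lambda>m. a (m - v))"

definition int_smult :: "int \<Rightarrow> 'g::ab_group_add \<Rightarrow> 'g" where
  "int_smult n x = (if 0 \<le> n then (\<Sum>i<nat n. x) else - (\<Sum>i<nat (- n). x))"

text \<open>
  The coefficients are nonzero integers, which may still act as zero on \<open>'a\<close>.
\<close>

definition linear_cellular_automaton ::
    "(('d::finite, 'a::ab_group_add) config \<Rightarrow> ('d, 'a) config) \<Rightarrow> bool" where
  "linear_cellular_automaton \<Phi> \<longleftrightarrow>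
     (\<exists>(F :: (int ^ 'd) set) (\<phi> :: int ^ 'd \<Rightarrow> int).
        finite F \<and> 2 \<le> card F \<and> (\<forall>f\<in>F. \<phi> f \<noteq> 0) \<and>
        (\<forall>a. \<Phi> a = (\<Sum>f\<in>F. int_smult (\<phi> f) (shift f a))))"

definition density_one :: "nat set \<Rightarrow> bool" where
  "density_one J \<longleftrightarrow> (\<lambda>N. real (card (J \<inter> {0..<N})) / real N) \<longlonglongrightarrow> 1"

text \<open>The filter for limits \<open>j \<rightarrow> \<infinity>\<close> with \<open>j\<close> ranging over \<open>J\<close>.\<close>

definition sequentially_in :: "nat set \<Rightarrow> nat filter" where
  "sequentially_in J = inf sequentially (principal J)"

definition weak_star_tendsto ::
    "(nat \<Rightarrow> 'x::topological_space measure) \<Rightarrow> 'x measure \<Rightarrow> nat filter \<Rightarrow> bool" where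
  "weak_star_tendsto \<nu> \<eta> F \<longleftrightarrow>
     (\<forall>f :: 'x \<Rightarrow> real. continuous_on UNIV f \<longrightarrow>
        ((\<lambda>j. integral\<^sup>L (\<nu> j) f) \<longlongrightarrow> integral\<^sup>L \<eta> f) F)"

definition uniform_bernoulli :: "('i \<Rightarrow> 'a::finite) measure" where
  "uniform_bernoulli = Pi\<^sub>M UNIV (\<lambda>_. uniform_count_measure UNIV)"

lemma sets_uniform_bernoulli:
  "sets (uniform_bernoulli :: ('i::countable \<Rightarrow> 'a::finite_discrete_ab_group) measure) = sets borel"
proof -
  have "sets (uniform_count_measure (UNIV :: 'a set)) = sets borel"
    by (auto simp: sets_uniform_count_measure intro: borel_open Topological_Spaces.open_discrete)
  then have "sets (uniform_bernoulli :: ('i \<Rightarrow> 'a) measure) = sets (Pi\<^sub>M UNIV (\<lambda>_. borel))"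
    unfolding uniform_bernoulli_def by (intro sets_PiM_cong) auto
  then show ?thesis
    by (simp add: sets_PiM_equal_borel)
qed

definition asymptotically_randomizes ::
    "(('d::finite, 'a::finite_discrete_ab_group) config \<Rightarrow> ('d, 'a) config) \<Rightarrow>
     ('d, 'a) config measure \<Rightarrow> bool" where
  "asymptotically_randomizes \<Phi> \<mu> \<longleftrightarrow>
     (\<exists>J. density_one J \<and>
        weak_star_tendsto (\<lambda>j. distr \<mu> borel (\<Phi> ^^ j)) uniform_bernoulli (sequentially_in J))"

text \<open>Used both for \<open>'a\<close> itself, where continuity is automatic, and for configurations.\<close>

definition character :: "('g::{topological_space, ab_group_add} \<Rightarrow> complex) \<Rightarrow> bool" where
  "character \<xi> \<longleftrightarrow> continuous_on UNIV \<xi> \<and> (\<forall>x. norm (\<xi> x) = 1) \<and>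
     (\<forall>x y. \<xi> (x + y) = \<xi> x * \<xi> y)"

definition nontrivial_character :: "('g::{topological_space, ab_group_add} \<Rightarrow> complex) \<Rightarrow> bool"
  where "nontrivial_character \<xi> \<longleftrightarrow> character \<xi> \<and> \<xi> \<noteq> (\<lambda>_. 1)"

definition has_support ::
    "(('d::finite, 'a::finite_discrete_ab_group) config \<Rightarrow> complex) \<Rightarrow> (int ^ 'd) set \<Rightarrow> bool" where
  "has_support \<xi> K \<longleftrightarrow> finite K \<and>
     (\<exists>\<psi> :: int ^ 'd \<Rightarrow> 'a \<Rightarrow> complex.
        (\<forall>k\<in>K. nontrivial_character (\<psi> k)) \<and> (\<forall>a. \<xi> a = (\<Prod>k\<in>K. \<psi> k (a k))))"

definition l1_norm :: "int ^ 'd::finite \<Rightarrow> int" where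
  "l1_norm m = (\<Sum>i\<in>UNIV. \<bar>m $ i\<bar>)"

definition S_separated ::
    "real \<Rightarrow> (('d::finite, 'a::finite_discrete_ab_group) config \<Rightarrow> complex) \<Rightarrow>
     (('d, 'a) config \<Rightarrow> complex) \<Rightarrow> bool" where
  "S_separated S \<xi> \<xi>' \<longleftrightarrow>
     (\<exists>K X. has_support \<xi> K \<and> has_support \<xi>' X \<and>
        (\<forall>k\<in>K. \<forall>x\<in>X. S \<le> real_of_int (l1_norm (k - x))))"

text \<open>
  For \<open>S > 0\<close> separated characters have disjoint supports, so the number of factors below is
  bounded by the size of the support and the maximum exists.
\<close>

definition char_rank ::
    "real \<Rightarrow> (('d::finite, 'a::finite_discrete_ab_group) config \<Rightarrow> complex) \<Rightarrow> nat" where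
  "char_rank S \<xi> =
     (if \<xi> = (\<lambda>_. 1) then 0
      else GREATEST R. \<exists>c :: nat \<Rightarrow> ('d, 'a) config \<Rightarrow> complex.
        (\<forall>i<R. nontrivial_character (c i)) \<and>
        (\<forall>i<R. \<forall>j<R. i \<noteq> j \<longrightarrow> S_separated S (c i) (c j)) \<and>
        (\<forall>a. \<xi> a = (\<Prod>i<R. c i a)))"

definition dispersion_mixing ::
    "('d::finite, 'a::finite_discrete_ab_group) config measure \<Rightarrow> bool" where
  "dispersion_mixing \<mu> \<longleftrightarrow>
     (\<forall>\<epsilon>>0. \<exists>S>0. \<exists>R>0. \<forall>\<xi>. character \<xi> \<and> real (char_rank S \<xi>) > R \<longrightarrow>
        norm (integral\<^sup>L \<mu> \<xi>) < \<epsilon>)"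

definition dispersive ::
    "(('d::finite, 'a::finite_discrete_ab_group) config \<Rightarrow> ('d, 'a) config) \<Rightarrow> bool" where
  "dispersive \<Phi> \<longleftrightarrow>
     (\<forall>S>0. \<forall>\<xi>. nontrivial_character \<xi> \<longrightarrow>
        (\<exists>J. density_one J \<and>
           filterlim (\<lambda>j. char_rank S (\<xi> \<circ> (\<Phi> ^^ j))) at_top (sequentially_in J)))"

end

theory Submission
  imports Defs
begin

text \<open>
  Write \<open>\<eta>\<close> for the Haar measure. A nontrivial character \<open>\<xi>\<close> has \<open>\<eta>\<close>-integral \<open>0\<close>, and its integral
  against \<open>\<Phi>\<^sup>j \<mu>\<close> is the \<open>\<mu>\<close>-integral of the character \<open>\<xi> \<circ> \<Phi>\<^sup>j\<close>. Dispersion makes the rank of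
  \<open>\<xi> \<circ> \<Phi>\<^sup>j\<close> large for \<open>j\<close> in a set of density one, and dispersion mixing then makes the integral
  small. So along a suitable set of times each character has the limit integral that Haar measure
  prescribes, and weak* convergence follows once finite combinations of characters are uniformly
  dense in the continuous functions.

  Two points need care. The density-one set that dispersion provides depends on \<open>\<xi>\<close> and on the
  separation \<open>S\<close>, and \<open>S\<close> in turn depends on the tolerance \<open>\<epsilon>\<close>. Only countably many pairs matter:
  it is enough to treat \<open>\<epsilon> = 1 / (n + 1)\<close> and the characters that are finite products of
  coordinate characters. Countably many density-one sets have a common density-one subset up to
  finite errors (\<open>density_one_pseudo_intersection\<close>), and finite errors do not affect limits; this
  yields \<open>density_one_integrals_tendsto_0\<close>.

  Density of the trigonometric polynomials (\<open>trig_polynomials_dense\<close>) is the Stone--Weierstrass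
  theorem on the compact space of configurations. Its only nontrivial hypothesis is that characters
  separate points, which reduces to one coordinate, that is, to a finite abelian group
  (\<open>characters_separate_points\<close>). There a character is produced as a common eigenvector of the
  translation operators inside an invariant space of functions
  (\<open>invariant_subspace_contains_character\<close>).
\<close>

section \<open>Separation of points in product spaces\<close>

text \<open>
  The Stone--Weierstrass theorem is stated for types of class \<open>t2_space\<close>. The instances for the
  weaker separation axioms come first because the arities of a function type must grow along the
  class hierarchy, and countable products of metric spaces already carry more special ones.
\<close>

lemma open_coordinate_vimage:
  fixes W :: "'b::topological_space set"
  assumes "open W"
  shows "open ((\<lambda>z :: 'i \<Rightarrow> 'b. z i) -` W)"
  using assms by (intro open_vimage) auto

instance "fun" :: (type, t0_space) t0_space
proof
  fix x y :: "'a \<Rightarrow> 'b"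
  assume "x \<noteq> y"
  then obtain i where i: "x i \<noteq> y i"
    by blast
  obtain U where "open U" "(x i \<in> U) \<noteq> (y i \<in> U)"
    using t0_space_class.t0_space[OF i] by blast
  then show "\<exists>U. open U \<and> (x \<in> U) \<noteq> (y \<in> U)"
    by (intro exI[of _ "(\<lambda>z. z i) -` U"]) (auto intro: open_coordinate_vimage)
qed

instance "fun" :: (type, t1_space) t1_space
proof
  fix x y :: "'a \<Rightarrow> 'b"
  assume "x \<noteq> y"
  then obtain i where i: "x i \<noteq> y i"
    by blast
  obtain U where "open U" "x i \<in> U" "y i \<notin> U"
    using t1_space_class.t1_space[OF i] by blast
  then show "\<exists>U. open U \<and> x \<in> U \<and> y \<notin> U"
    by (intro exI[of _ "(\<lambda>z. z i) -` U"]) (auto intro: open_coordinate_vimage)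
qed

instance "fun" :: (type, t2_space) t2_space
proof
  fix x y :: "'a \<Rightarrow> 'b"
  assume "x \<noteq> y"
  then obtain i where i: "x i \<noteq> y i"
    by blast
  obtain U V where "open U" "open V" "x i \<in> U" "y i \<in> V" "U \<inter> V = {}"
    using hausdorff[OF i] by blast
  then show "\<exists>U V. open U \<and> open V \<and> x \<in> U \<and> y \<in> V \<and> U \<inter> V = {}"
    by (intro exI[of _ "(\<lambda>z. z i) -` U"] exI[of _ "(\<lambda>z. z i) -` V"])
       (auto intro: open_coordinate_vimage)
qed

section \<open>Sets of density one\<close>

lemma relative_count_le_1: "real (card (X \<inter> {0..<N})) / real N \<le> 1"
proof -
  have "card (X \<inter> {0..<N}) \<le> card {0..<N}"
    by (intro card_mono) auto
  then show ?thesis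
    by (simp add: divide_le_eq)
qed

text \<open>Both complements have density zero, hence so has their union.\<close>
lemma density_one_Int:
  assumes "density_one A" "density_one B"
  shows "density_one (A \<inter> B)"
proof -
  let ?d = "\<lambda>X N. real (card (X \<inter> {0..<N})) / real N"
  have lower: "?d A N + ?d B N - 1 \<le> ?d (A \<inter> B) N" if "N > 0" for N
  proof -
    let ?A = "A \<inter> {0..<N}" and ?B = "B \<inter> {0..<N}"
    have "card ?A + card ?B = card (?A \<union> ?B) + card (?A \<inter> ?B)"
      by (intro card_Un_Int) auto
    moreover have "card (?A \<union> ?B) \<le> card {0..<N}"
      by (intro card_mono) auto
    moreover have "?A \<inter> ?B = A \<inter> B \<inter> {0..<N}"
      by auto
    ultimately have "real (card ?A) + real (card ?B) - real N \<le> real (card (A \<inter> B \<inter> {0..<N}))"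
      by simp
    then have "(real (card ?A) + real (card ?B) - real N) / real N \<le> ?d (A \<inter> B) N"
      by (intro divide_right_mono) auto
    with that show ?thesis
      by (simp add: add_divide_distrib diff_divide_distrib)
  qed
  have "(\<lambda>N. ?d A N + ?d B N - 1) \<longlonglongrightarrow> 1 + 1 - 1"
    using assms unfolding density_one_def by (intro tendsto_intros)
  then show ?thesis
    unfolding density_one_def
    using lower relative_count_le_1
    by (intro tendsto_sandwich[of _ "?d (A \<inter> B)" _ "\<lambda>_. 1" 1])
       (auto intro: eventually_sequentiallyI[of 1])
qed

text \<open>
  The intersection of all \<open>A n\<close> may be empty, but a diagonal set does the job: \<open>J\<close> is required to
  lie in \<open>A 0 \<inter> \<dots> \<inter> A n\<close> only from a time \<open>T n\<close> on, where \<open>T n\<close> is so late that this finite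
  intersection has already reached proportion \<open>1 - 1 / (n + 1)\<close> in every longer initial segment.
\<close>
lemma density_one_pseudo_intersection:
  fixes A :: "nat \<Rightarrow> nat set"
  assumes A: "\<And>n. density_one (A n)"
  obtains J where "density_one J" and "\<And>n. finite (J - A n)"
proof -
  let ?d = "\<lambda>X N. real (card (X \<inter> {0..<N})) / real N"
  define B where "B n = (\<Inter>i\<le>n. A i)" for n
  have B: "density_one (B n)" for n
  proof (induction n)
    case 0
    then show ?case
      by (simp add: B_def A)
  next
    case (Suc n)
    have "B (Suc n) = B n \<inter> A (Suc n)"
      unfolding B_def by (auto simp: le_Suc_eq)
    then show ?case
      using Suc A density_one_Int by simp
  qed
  have "\<exists>M. \<forall>N\<ge>M. 1 - inverse (real (Suc n)) < ?d (B n) N" for n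
    using order_tendstoD(1)[OF B[of n, unfolded density_one_def], of "1 - inverse (real (Suc n))"]
    by (simp add: eventually_sequentially)
  then have "\<exists>M. \<forall>n. \<forall>N\<ge>M n. 1 - inverse (real (Suc n)) < ?d (B n) N"
    by (intro choice allI)
  then obtain M where M: "\<And>n N. M n \<le> N \<Longrightarrow> 1 - inverse (real (Suc n)) < ?d (B n) N"
    by blast
  \<comment> \<open>The bound \<open>n \<le> T n\<close> leaves only finitely many constraints active below any given time.\<close>
  define T where "T n = max n (M n)" for n
  define J where "J = {j. \<forall>n. T n \<le> j \<longrightarrow> j \<in> B n}"
  have lower: "1 - inverse (real (Suc k)) < ?d J N" if "T k \<le> N" for k N
  proof -
    \<comment> \<open>Below \<open>N\<close> only constraints with index at most this \<open>n\<close> are active, and \<open>B n\<close> meets them all.\<close>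
    define n where "n = (GREATEST n. T n \<le> N)"
    have bound: "\<And>m. T m \<le> N \<Longrightarrow> m \<le> N"
      by (simp add: T_def)
    have n: "T n \<le> N"
      unfolding n_def using GreatestI_nat[of "\<lambda>n. T n \<le> N", OF that bound] .
    have greatest: "m \<le> n" if "T m \<le> N" for m
      unfolding n_def using Greatest_le_nat[of "\<lambda>n. T n \<le> N", OF that bound] .
    have "B n \<inter> {0..<N} \<subseteq> J \<inter> {0..<N}"
    proof safe
      fix j assume j: "j \<in> B n" "j \<in> {0..<N}"
      show "j \<in> J"
        unfolding J_def
      proof safe
        fix m assume "T m \<le> j"
        then have "m \<le> n"
          using j greatest by auto
        with j show "j \<in> B m"
          by (auto simp: B_def)
      qed
    qed
    then have "card (B n \<inter> {0..<N}) \<le> card (J \<inter> {0..<N})"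
      by (intro card_mono) auto
    then have "?d (B n) N \<le> ?d J N"
      by (intro divide_right_mono) auto
    moreover have "1 - inverse (real (Suc n)) < ?d (B n) N"
      using n by (intro M) (simp add: T_def)
    moreover have "inverse (real (Suc n)) \<le> inverse (real (Suc k))"
      using greatest[OF that] by (intro le_imp_inverse_le) auto
    ultimately show ?thesis
      by linarith
  qed
  have "density_one J"
    unfolding density_one_def
  proof (rule LIMSEQ_I)
    fix r :: real assume "0 < r"
    then obtain k where k: "inverse (real (Suc k)) < r"
      using reals_Archimedean[of r] by auto
    have "norm (?d J N - 1) < r" if "T k \<le> N" for N
      using k lower[OF that] relative_count_le_1[of J N] unfolding real_norm_def by linarith
    then show "\<exists>N0. \<forall>N\<ge>N0. norm (?d J N - 1) < r"
      by blast
  qed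
  moreover have "finite (J - A n)" for n
  proof (rule finite_subset)
    show "J - A n \<subseteq> {..<T n}"
    proof
      fix j assume j: "j \<in> J - A n"
      then have "j \<notin> B n"
        by (auto simp: B_def)
      moreover have "T n \<le> j \<longrightarrow> j \<in> B n"
        using j by (simp add: J_def)
      ultimately show "j \<in> {..<T n}"
        by auto
    qed
  qed simp
  ultimately show thesis
    by (rule that)
qed

lemma sequentially_in_mono:
  assumes "finite (J - A)"
  shows "sequentially_in J \<le> sequentially_in A"
proof -
  obtain M where M: "J - A \<subseteq> {..<M}"
    using assms finite_nat_bounded by blast
  have "eventually (\<lambda>j. j \<in> A) (sequentially_in J)"
    unfolding sequentially_in_def eventually_inf_principal
    using M by (intro eventually_sequentiallyI[of M]) auto
  then show ?thesis
    by (simp add: sequentially_in_def le_principal)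
qed


section \<open>Characters of finite abelian groups\<close>

text \<open>
  Lagrange's theorem for the element \<open>b\<close>: translation by \<open>b\<close> permutes the group, so summing all
  elements before and after it gives the same total. The multiple of \<open>b\<close> by \<open>k\<close> is written as a
  sum of \<open>k\<close> copies here and below.
\<close>
lemma sum_card_copies_eq_0:
  fixes b :: "'a::{finite, ab_group_add}"
  shows "(\<Sum>i<CARD('a). b) = 0"
proof -
  obtain h :: "nat \<Rightarrow> 'a" where "bij_betw h {0..<CARD('a)} UNIV"
    using ex_bij_betw_nat_finite[of "UNIV :: 'a set"] by auto
  then have "(\<Sum>i<CARD('a). b) = (\<Sum>x\<in>(UNIV :: 'a set). b)"
    using sum.reindex_bij_betw[of h "{0..<CARD('a)}" UNIV "\<lambda>_. b"]
    by (simp only: atLeast0LessThan)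
  moreover have "(\<Sum>x\<in>UNIV. x + b) = (\<Sum>x\<in>UNIV. x :: 'a)"
    by (rule sum.reindex_bij_witness[of _ "\<lambda>x. x - b" "\<lambda>x. x + b"]) auto
  ultimately show ?thesis
    by (simp add: sum.distrib)
qed

text \<open>
  The sum below is, up to a factor, the projection of \<open>f\<close> to an eigenspace of translation by \<open>b\<close>.
  At a point \<open>x\<close> with \<open>f x \<noteq> 0\<close> it is a polynomial in \<open>\<zeta>\<close> of degree less than \<open>CARD('a)\<close> with
  constant coefficient \<open>f x\<close>, so it cannot vanish at all \<open>CARD('a)\<close> roots of unity.
\<close>
lemma exists_nonzero_translation_transform:
  fixes f :: "'a::{finite, ab_group_add} \<Rightarrow> complex"
  assumes "f \<noteq> (\<lambda>_. 0)"
  obtains \<zeta> where "\<zeta> ^ CARD('a) = 1"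
    and "(\<lambda>x. \<Sum>k<CARD('a). \<zeta> ^ k * f (x + (\<Sum>i<k. b))) \<noteq> (\<lambda>_. 0)"
proof (rule ccontr)
  let ?n = "CARD('a)"
  assume "\<not> thesis"
  with that have zero: "(\<Sum>k<?n. \<zeta> ^ k * f (x + (\<Sum>i<k. b))) = 0" if "\<zeta> ^ ?n = 1" for \<zeta> x
    using that by meson
  obtain x where x: "f x \<noteq> 0"
    using assms by blast
  have n: "{..<?n} = {..?n - 1}"
    using lessThan_Suc_atMost[of "?n - 1"] by simp
  have roots: "{z. z ^ ?n = 1} \<subseteq> {z. (\<Sum>k\<le>?n - 1. f (x + (\<Sum>i<k. b)) * z ^ k) = 0}"
    using zero[of _ x] by (auto simp: n mult.commute)
  have "finite {z. (\<Sum>k\<le>?n - 1. f (x + (\<Sum>i<k. b)) * z ^ k) = 0} \<and>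
        card {z. (\<Sum>k\<le>?n - 1. f (x + (\<Sum>i<k. b)) * z ^ k) = 0} \<le> ?n - 1"
    by (rule polyfun_rootbound) (use x in \<open>auto intro!: exI[of _ 0]\<close>)
  then have "card {z :: complex. z ^ ?n = 1} \<le> ?n - 1"
    using card_mono[OF _ roots] by linarith
  moreover have "card {z :: complex. z ^ ?n = 1} = ?n"
    by (rule card_roots_unity_eq) simp
  ultimately show False
    using zero_less_card_finite[where 'a = 'a] by linarith
qed

text \<open>Translation by \<open>b\<close> shifts the summation index, which is cyclic modulo \<open>CARD('a)\<close>.\<close>
lemma translation_transform_eigenfunction:
  fixes f :: "'a::{finite, ab_group_add} \<Rightarrow> complex" and b :: 'a
  assumes "\<zeta> ^ CARD('a) = 1"
  defines "g \<equiv> \<lambda>x. \<Sum>k<CARD('a). \<zeta> ^ k * f (x + (\<Sum>i<k. b))"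
  shows "\<zeta> * g (x + b) = g x"
proof -
  let ?n = "CARD('a)" and ?h = "\<lambda>k. \<zeta> ^ k * f (x + (\<Sum>i<k. b))"
  have "\<zeta> * g (x + b) = (\<Sum>k<?n. ?h (Suc k))"
    unfolding g_def sum_distrib_left by (intro sum.cong) (auto simp: algebra_simps)
  moreover have "?h ?n = ?h 0"
    by (simp add: assms(1) sum_card_copies_eq_0)
  ultimately show ?thesis
    using sum.lessThan_Suc[of ?h ?n] sum.lessThan_Suc_shift[of ?h ?n]
    by (simp add: g_def)
qed

text \<open>
  Translations commute, so projecting to an eigenspace of one of them preserves the eigenspaces of
  the others; doing this for every group element in turn, each time with a projection that does not
  kill the function, gives a common eigenfunction in \<open>V\<close>. Its value at \<open>0\<close> is nonzero, and after
  normalization it is a character because its eigenvalues are its values.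
\<close>
lemma invariant_subspace_contains_character:
  fixes V :: "('a::finite_discrete_ab_group \<Rightarrow> complex) set"
  assumes add: "\<And>f g. f \<in> V \<Longrightarrow> g \<in> V \<Longrightarrow> (\<lambda>x. f x + g x) \<in> V"
    and scale: "\<And>f c. f \<in> V \<Longrightarrow> (\<lambda>x. c * f x) \<in> V"
    and translate: "\<And>f b. f \<in> V \<Longrightarrow> (\<lambda>x. f (x + b)) \<in> V"
    and nonzero: "f0 \<in> V" "f0 \<noteq> (\<lambda>_. 0)"
  shows "\<exists>\<psi>\<in>V. character \<psi>"
proof -
  have sum: "(\<lambda>x. \<Sum>k<n. h k x) \<in> V" if "\<And>k. h k \<in> V" for h and n :: nat
  proof (induction n)
    case 0
    then show ?case
      using scale[OF nonzero(1), of 0] by simp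
  next
    case (Suc n)
    then show ?case
      using add[OF Suc that[of n]] by (simp add: add.commute)
  qed
  have "\<exists>f\<in>V. f \<noteq> (\<lambda>_. 0) \<and> (\<forall>b\<in>B. \<exists>\<zeta>. \<zeta> ^ CARD('a) = 1 \<and> (\<forall>x. \<zeta> * f (x + b) = f x))"
    if "finite B" for B
    using that
  proof (induction B)
    case empty
    then show ?case
      using nonzero by auto
  next
    case (insert b B)
    then obtain f where f: "f \<in> V" "f \<noteq> (\<lambda>_. 0)"
      and eigen: "\<And>b. b \<in> B \<Longrightarrow> \<exists>\<zeta>. \<zeta> ^ CARD('a) = 1 \<and> (\<forall>x. \<zeta> * f (x + b) = f x)"
      by blast
    obtain \<zeta> where \<zeta>: "\<zeta> ^ CARD('a) = 1"
      and "(\<lambda>x. \<Sum>k<CARD('a). \<zeta> ^ k * f (x + (\<Sum>i<k. b))) \<noteq> (\<lambda>_. 0)"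
      using exists_nonzero_translation_transform[OF f(2)] by blast
    moreover define g where "g = (\<lambda>x. \<Sum>k<CARD('a). \<zeta> ^ k * f (x + (\<Sum>i<k. b)))"
    ultimately have "g \<noteq> (\<lambda>_. 0)"
      by simp
    moreover have "g \<in> V"
      unfolding g_def by (rule sum, rule scale, rule translate, rule f)
    moreover have "\<exists>\<zeta>. \<zeta> ^ CARD('a) = 1 \<and> (\<forall>x. \<zeta> * g (x + c) = g x)" if c: "c \<in> insert b B" for c
    proof (cases "c = b")
      case True
      then show ?thesis
        using \<zeta> translation_transform_eigenfunction[OF \<zeta>] unfolding g_def by blast
    next
      case False
      with c eigen obtain \<xi> where \<xi>: "\<xi> ^ CARD('a) = 1" "\<And>x. \<xi> * f (x + c) = f x"
        by blast
      have "\<xi> * g (x + c) = g x" for x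
      proof -
        have "\<xi> * (\<zeta> ^ k * f (x + c + t)) = \<zeta> ^ k * f (x + t)" for k t
          using \<xi>(2)[of "x + t"] by (simp add: ac_simps)
        then show ?thesis
          unfolding g_def sum_distrib_left by (intro sum.cong refl)
      qed
      with \<xi> show ?thesis
        by blast
    qed
    ultimately show ?case
      by blast
  qed
  from this[of UNIV] obtain f where f: "f \<in> V" "f \<noteq> (\<lambda>_. 0)"
    and "\<forall>b. \<exists>\<zeta>. \<zeta> ^ CARD('a) = 1 \<and> (\<forall>x. \<zeta> * f (x + b) = f x)"
    by auto
  then obtain \<zeta> where \<zeta>: "\<And>b. \<zeta> b ^ CARD('a) = 1" "\<And>b x. \<zeta> b * f (x + b) = f x"
    by metis
  have norm_\<zeta>: "norm (\<zeta> b) = 1" for b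
    using power_eq_1_iff[OF \<zeta>(1)[of b]] by simp
  have nz: "\<zeta> b \<noteq> 0" for b
    using norm_\<zeta>[of b] by (metis norm_zero zero_neq_one)
  have f0: "f b = inverse (\<zeta> b) * f 0" for b
    using \<zeta>(2)[of b 0] nz[of b] by (simp add: field_simps)
  have "f 0 \<noteq> 0"
  proof
    assume "f 0 = 0"
    then have "f b = 0" for b
      using f0[of b] by simp
    with f(2) show False
      by blast
  qed
  define \<psi> where "\<psi> x = inverse (f 0) * f x" for x
  have \<psi>: "\<psi> b = inverse (\<zeta> b)" for b
    using \<open>f 0 \<noteq> 0\<close> by (simp add: \<psi>_def f0[of b])
  have "\<psi> (x + b) = \<psi> x * \<psi> b" for x b
    using \<zeta>(2)[of b x] nz[of b] \<open>f 0 \<noteq> 0\<close> unfolding \<psi>[of b] by (simp add: \<psi>_def field_simps)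
  then have "character \<psi>"
    by (simp add: character_def \<psi> norm_inverse norm_\<zeta>)
  moreover have "\<psi> \<in> V"
    unfolding \<psi>_def by (rule scale, rule f)
  ultimately show ?thesis
    by blast
qed

lemma character_add: "character \<xi> \<Longrightarrow> \<xi> (x + y) = \<xi> x * \<xi> y"
  by (simp add: character_def)

lemma norm_character: "character \<xi> \<Longrightarrow> norm (\<xi> x) = 1"
  by (simp add: character_def)

lemma character_0: "character \<xi> \<Longrightarrow> \<xi> 0 = 1"
  using character_add[of \<xi> 0 0] norm_character[of \<xi> 0] by auto

lemma character_sum_copies:
  assumes "character \<xi>"
  shows "\<xi> (\<Sum>i<k. b) = \<xi> b ^ (k :: nat)"
  by (induction k) (simp_all add: character_0[OF assms] character_add[OF assms])

text \<open>
  With \<open>a = x - y\<close>, consider the translation-invariant space of functions whose sum over the orbit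
  \<open>z, z + a, z + 2a, \<dots>\<close> vanishes for every \<open>z\<close>. A character in this space cannot take the value
  \<open>1\<close> at \<open>a\<close>, since the sum starting at \<open>0\<close> would then be \<open>CARD('a)\<close>. The space is nonzero: it contains
  the difference of the indicators of \<open>-a\<close> and \<open>0\<close>, whose orbit sums telescope.
\<close>
lemma characters_separate_points:
  fixes x y :: "'a::finite_discrete_ab_group"
  assumes "x \<noteq> y"
  obtains \<psi> where "character \<psi>" and "\<psi> x \<noteq> \<psi> y"
proof -
  let ?n = "CARD('a)"
  define a where "a = x - y"
  define V where "V = {f :: 'a \<Rightarrow> complex. \<forall>x. (\<Sum>k<?n. f (x + (\<Sum>i<k. a))) = 0}"
  define f0 :: "'a \<Rightarrow> complex" where "f0 x = (if x + a = 0 then 1 else 0) - (if x = 0 then 1 else 0)" for x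
  have "f0 \<in> V"
  proof -
    have "(\<Sum>k<?n. f0 (z + (\<Sum>i<k. a))) = 0" for z
    proof -
      define h :: "nat \<Rightarrow> complex" where "h k = (if z + (\<Sum>i<k. a) = 0 then 1 else 0)" for k
      have "f0 (z + (\<Sum>i<k. a)) = h (Suc k) - h k" for k
        by (simp add: f0_def h_def ac_simps)
      then have "(\<Sum>k<?n. f0 (z + (\<Sum>i<k. a))) = h ?n - h 0"
        by (simp only: sum_lessThan_telescope)
      also have "h ?n = h 0"
        by (simp add: h_def sum_card_copies_eq_0)
      finally show ?thesis
        by simp
    qed
    then show ?thesis
      by (simp add: V_def)
  qed
  moreover have "f0 0 \<noteq> 0"
    using assms by (simp add: f0_def a_def)
  ultimately have "\<exists>\<psi>\<in>V. character \<psi>"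
  proof (intro invariant_subspace_contains_character[where ?f0.0 = f0])
    fix f b assume "f \<in> V"
    show "(\<lambda>x. f (x + b)) \<in> V"
      unfolding V_def
    proof safe
      fix z
      have "(\<Sum>k<?n. f (z + b + (\<Sum>i<k. a))) = 0"
        using \<open>f \<in> V\<close> by (simp add: V_def)
      then show "(\<Sum>k<?n. f (z + (\<Sum>i<k. a) + b)) = 0"
        by (simp add: ac_simps)
    qed
  qed (auto simp: V_def sum.distrib sum_distrib_left[symmetric])
  then obtain \<psi> where \<psi>: "\<psi> \<in> V" "character \<psi>"
    by blast
  have "\<psi> a \<noteq> 1"
  proof
    assume "\<psi> a = 1"
    then have "(\<Sum>k<?n. \<psi> (0 + (\<Sum>i<k. a))) = of_nat ?n"
      by (simp add: character_sum_copies[OF \<psi>(2)])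
    moreover have "(\<Sum>k<?n. \<psi> (0 + (\<Sum>i<k. a))) = 0"
      using \<psi>(1) unfolding V_def by blast
    ultimately show False
      by simp
  qed
  moreover have "\<psi> x = \<psi> a * \<psi> y"
    using character_add[OF \<psi>(2), of a y] by (simp add: a_def)
  ultimately have "\<psi> x \<noteq> \<psi> y"
    using norm_character[OF \<psi>(2), of y] by auto
  with \<psi>(2) show thesis
    by (rule that)
qed

text \<open>By Lagrange's theorem the values of a character are roots of unity of order \<open>CARD('a)\<close>.\<close>
lemma finite_characters: "finite {\<psi> :: 'a::finite_discrete_ab_group \<Rightarrow> complex. character \<psi>}"
proof (rule finite_subset)
  show "{\<psi> :: 'a \<Rightarrow> complex. character \<psi>} \<subseteq> (\<Pi>\<^sub>E x\<in>UNIV. {z. z ^ CARD('a) = 1})"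
    using character_sum_copies[where k = "CARD('a)" and 'a = 'a]
    by (auto simp: sum_card_copies_eq_0 character_0)
  show "finite (\<Pi>\<^sub>E x\<in>(UNIV :: 'a set). {z :: complex. z ^ CARD('a) = 1})"
    by (intro finite_PiE finite_roots_unity) (auto simp: Suc_le_eq)
qed

text \<open>Translating by \<open>b\<close> multiplies the sum by \<open>\<psi> b\<close>, which can be chosen different from \<open>1\<close>.\<close>
lemma sum_nontrivial_character:
  fixes \<psi> :: "'a::finite_discrete_ab_group \<Rightarrow> complex"
  assumes "character \<psi>" "\<psi> \<noteq> (\<lambda>_. 1)"
  shows "(\<Sum>x\<in>UNIV. \<psi> x) = 0"
proof -
  obtain b where b: "\<psi> b \<noteq> 1"
    using assms(2) by blast
  have "(\<Sum>x\<in>UNIV. \<psi> x) = (\<Sum>x\<in>UNIV. \<psi> (x + b))"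
    by (rule sum.reindex_bij_witness[of _ "\<lambda>x. x + b" "\<lambda>x. x - b"]) auto
  also have "\<dots> = (\<Sum>x\<in>UNIV. \<psi> x) * \<psi> b"
    by (simp add: character_add[OF assms(1)] sum_distrib_right)
  finally show ?thesis
    using b by simp
qed

section \<open>Finite products of coordinate characters\<close>

text \<open>
  The coordinate characters \<open>\<psi> k\<close> may be trivial, which makes closure under products immediate;
  these functions are the characters of the product group, in a form that is visibly countable.
\<close>
definition product_characters :: "(('i \<Rightarrow> 'a::finite_discrete_ab_group) \<Rightarrow> complex) set" where
  "product_characters =
     {\<lambda>x. \<Prod>k\<in>K. \<psi> k (x k) | K \<psi>. finite K \<and> (\<forall>k. character (\<psi> k))}"

lemma product_charactersI:
  "finite K \<Longrightarrow> (\<And>k. character (\<psi> k)) \<Longrightarrow> (\<lambda>x. \<Prod>k\<in>K. \<psi> k (x k)) \<in> product_characters"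
  unfolding product_characters_def by blast

lemma product_charactersE:
  assumes "\<xi> \<in> product_characters"
  obtains K \<psi> where "finite K" "\<And>k. character (\<psi> k)" "\<xi> = (\<lambda>x. \<Prod>k\<in>K. \<psi> k (x k))"
  using assms unfolding product_characters_def by blast

lemma character_one: "character (\<lambda>_. 1)"
  by (simp add: character_def)

lemma character_cnj: "character \<xi> \<Longrightarrow> character (\<lambda>x. cnj (\<xi> x))"
  by (auto simp: character_def intro: continuous_intros)

lemma character_mult: "character \<xi> \<Longrightarrow> character \<xi>' \<Longrightarrow> character (\<lambda>x. \<xi> x * \<xi>' x)"
  by (auto simp: character_def norm_mult intro: continuous_intros)

lemma character_product_character:
  assumes "\<xi> \<in> product_characters"
  shows "character \<xi>"
proof -
  obtain K \<psi> where K: "finite K" "\<And>k. character (\<psi> k)" "\<xi> = (\<lambda>x. \<Prod>k\<in>K. \<psi> k (x k))"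
    using assms by (rule product_charactersE) (rule that)
  have "continuous_on UNIV (\<lambda>x. \<psi> k (x k))" for k
    by (rule continuous_on_compose2[of UNIV "\<psi> k"]) auto
  with K show ?thesis
    by (simp add: character_def continuous_on_prod prod_norm[symmetric] prod.distrib)
qed

lemma product_characters_cnj:
  assumes "\<xi> \<in> product_characters"
  shows "(\<lambda>x. cnj (\<xi> x)) \<in> product_characters"
proof -
  obtain K \<psi> where K: "finite K" "\<And>k. character (\<psi> k)" "\<xi> = (\<lambda>x. \<Prod>k\<in>K. \<psi> k (x k))"
    using assms by (rule product_charactersE) (rule that)
  show ?thesis
    using product_charactersI[OF K(1) character_cnj[OF K(2)]] by (simp add: K(3))
qed

lemma product_characters_one: "(\<lambda>_. 1) \<in> product_characters"
  using product_charactersI[of "{}" "\<lambda>_ _. 1"] by (simp add: character_one)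

lemma product_characters_mult:
  assumes "\<xi> \<in> product_characters" "\<xi>' \<in> product_characters"
  shows "(\<lambda>x. \<xi> x * \<xi>' x) \<in> product_characters"
proof -
  obtain K \<psi> where K: "finite K" "\<And>k. character (\<psi> k)" "\<xi> = (\<lambda>x. \<Prod>k\<in>K. \<psi> k (x k))"
    using assms(1) by (rule product_charactersE) (rule that)
  obtain L \<theta> where L: "finite L" "\<And>k. character (\<theta> k)" "\<xi>' = (\<lambda>x. \<Prod>k\<in>L. \<theta> k (x k))"
    using assms(2) by (rule product_charactersE) (rule that)
  define \<psi>' where "\<psi>' k = (if k \<in> K then \<psi> k else (\<lambda>_. 1))" for k
  define \<theta>' where "\<theta>' k = (if k \<in> L then \<theta> k else (\<lambda>_. 1))" for k
  have "\<xi> x = (\<Prod>k\<in>K \<union> L. \<psi>' k (x k))" for x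
    unfolding K(3) using K(1) L(1) by (intro prod.mono_neutral_cong_left) (auto simp: \<psi>'_def)
  moreover have "\<xi>' x = (\<Prod>k\<in>K \<union> L. \<theta>' k (x k))" for x
    unfolding L(3) using K(1) L(1) by (intro prod.mono_neutral_cong_left) (auto simp: \<theta>'_def)
  moreover have "character (\<lambda>a. \<psi>' k a * \<theta>' k a)" for k
    using K(2) L(2) by (intro character_mult) (auto simp: \<psi>'_def \<theta>'_def character_one)
  ultimately show ?thesis
    using product_charactersI[of "K \<union> L" "\<lambda>k a. \<psi>' k a * \<theta>' k a"] K(1) L(1)
    by (simp add: prod.distrib)
qed

lemma countable_product_characters:
  "countable (product_characters :: (('i::countable \<Rightarrow> 'a::finite_discrete_ab_group) \<Rightarrow> complex) set)"
proof -
  let ?X = "{\<psi> :: 'a \<Rightarrow> complex. character \<psi>}"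
  let ?F = "\<lambda>K (\<psi> :: 'i \<Rightarrow> 'a \<Rightarrow> complex) x. \<Prod>k\<in>K. \<psi> k (x k)"
  have "product_characters \<subseteq> (\<Union>K\<in>{K. finite K}. ?F K ` (\<Pi>\<^sub>E k\<in>K. ?X))"
  proof
    fix \<xi> :: "('i \<Rightarrow> 'a) \<Rightarrow> complex"
    assume "\<xi> \<in> product_characters"
    then obtain K \<psi> where K: "finite K" "\<And>k. character (\<psi> k)" "\<xi> = ?F K \<psi>"
      by (rule product_charactersE) (rule that)
    then have "\<xi> = ?F K (restrict \<psi> K)" "restrict \<psi> K \<in> (\<Pi>\<^sub>E k\<in>K. ?X)"
      by auto
    with K(1) show "\<xi> \<in> (\<Union>K\<in>{K. finite K}. ?F K ` (\<Pi>\<^sub>E k\<in>K. ?X))"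
      by blast
  qed
  moreover have "countable (\<Union>K\<in>{K. finite K}. ?F K ` (\<Pi>\<^sub>E k\<in>K. ?X))"
    by (intro countable_UN countable_Collect_finite countable_image countable_finite finite_PiE
          finite_characters) auto
  ultimately show ?thesis
    by (rule countable_subset)
qed

lemma product_characters_separate_points:
  fixes x y :: "'i \<Rightarrow> 'a::finite_discrete_ab_group"
  assumes "x \<noteq> y"
  obtains \<xi> where "\<xi> \<in> product_characters" and "\<xi> x \<noteq> \<xi> y"
proof -
  obtain i where "x i \<noteq> y i"
    using assms by blast
  then obtain \<psi> where "character \<psi>" "\<psi> (x i) \<noteq> \<psi> (y i)"
    by (rule characters_separate_points)
  then show thesis
    using that[OF product_charactersI[of "{i}" "\<lambda>_. \<psi>"]] by simp
qed

section \<open>Haar integrals of characters\<close>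

lemma prob_space_uniform_bernoulli: "prob_space uniform_bernoulli"
  unfolding uniform_bernoulli_def
  by (intro prob_space_PiM prob_space_uniform_count_measure) auto

text \<open>
  Only the coordinates in \<open>K\<close> enter, so the integral may be taken over the finite product measure,
  where it factors.
\<close>
lemma integral_uniform_bernoulli_prod:
  fixes f :: "'i \<Rightarrow> 'a::finite \<Rightarrow> complex"
  assumes "finite K"
  shows "(\<integral>x. (\<Prod>k\<in>K. f k (x k)) \<partial>uniform_bernoulli)
       = (\<Prod>k\<in>K. (\<Sum>a\<in>UNIV. f k a) / of_nat CARD('a))"
proof -
  let ?U = "\<lambda>_ :: 'i. uniform_count_measure (UNIV :: 'a set)"
  interpret U: prob_space "?U i" for i
    by (intro prob_space_uniform_count_measure) auto
  interpret product_prob_space ?U UNIV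
    by unfold_locales
  have f[measurable]: "f k \<in> borel_measurable (?U k)" for k
    by (simp add: measurable_def space_uniform_count_measure sets_uniform_count_measure)
  have integrable_f: "integrable (?U k) (f k)" for k
    unfolding uniform_count_measure_def by (intro integrable_point_measure_finite) auto
  have "(\<integral>x. (\<Prod>k\<in>K. f k (x k)) \<partial>uniform_bernoulli)
      = (\<integral>x. (\<Prod>k\<in>K. f k (restrict x K k)) \<partial>PiM UNIV ?U)"
    unfolding uniform_bernoulli_def by (intro Bochner_Integration.integral_cong prod.cong) auto
  also have "\<dots> = (\<integral>x. (\<Prod>k\<in>K. f k (x k)) \<partial>distr (PiM UNIV ?U) (PiM K ?U) (\<lambda>x. restrict x K))"
    by (subst integral_distr) (auto intro!: measurable_restrict_subset)
  also have "\<dots> = (\<integral>x. (\<Prod>k\<in>K. f k (x k)) \<partial>PiM K ?U)"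
    using assms by (subst distr_PiM_restrict_finite) auto
  also have "\<dots> = (\<Prod>k\<in>K. integral\<^sup>L (?U k) (f k))"
    using assms integrable_f by (rule product_integral_prod)
  also have "\<dots> = (\<Prod>k\<in>K. (\<Sum>a\<in>UNIV. f k a) / of_nat CARD('a))"
    unfolding uniform_count_measure_def
    by (intro prod.cong refl, subst lebesgue_integral_point_measure_finite)
       (auto simp: sum_divide_distrib scaleR_conv_of_real)
  finally show ?thesis .
qed

lemma integral_uniform_bernoulli_product_character:
  assumes "\<xi> \<in> product_characters" "\<xi> \<noteq> (\<lambda>_. 1)"
  shows "integral\<^sup>L uniform_bernoulli \<xi> = 0"
proof -
  obtain K \<psi> where K: "finite K" "\<And>k. character (\<psi> k)" "\<xi> = (\<lambda>x. \<Prod>k\<in>K. \<psi> k (x k))"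
    using assms(1) by (rule product_charactersE) (rule that)
  with assms(2) obtain k where "k \<in> K" "\<psi> k \<noteq> (\<lambda>_. 1)"
    by (metis (no_types, lifting) prod.neutral)
  then have "(\<Prod>k\<in>K. (\<Sum>a\<in>UNIV. \<psi> k a) / of_nat CARD('b)) = 0"
    using K by (intro prod_zero) (auto intro!: bexI[of _ k] simp: sum_nontrivial_character)
  then show ?thesis
    unfolding K(3) integral_uniform_bernoulli_prod[OF K(1)] .
qed

section \<open>Weak* convergence from convergence on characters\<close>

text \<open>Tychonoff's theorem.\<close>
lemma compact_UNIV_fun: "compact (UNIV :: ('i \<Rightarrow> 'a::finite_discrete_ab_group) set)"
proof -
  have "compact_space (product_topology (\<lambda>_ :: 'i. euclidean :: 'a topology) UNIV)"
    unfolding compact_space_product_topology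
    by (auto simp: compact_space_def intro: finite_imp_compact)
  then show ?thesis
    by (simp add: euclidean_product_topology compact_space_def)
qed

lemma integrable_continuous_fun:
  fixes f :: "('i \<Rightarrow> 'a::finite_discrete_ab_group) \<Rightarrow> 'b::{banach, second_countable_topology}"
  assumes "prob_space \<nu>" "sets \<nu> = sets borel" "continuous_on UNIV f"
  shows "integrable \<nu> f"
proof -
  interpret prob_space \<nu> by fact
  have "bounded (range f)"
    using compact_continuous_image[OF assms(3) compact_UNIV_fun] compact_imp_bounded by blast
  then obtain C where "\<And>x. norm (f x) \<le> C"
    by (auto simp: bounded_iff)
  moreover have "f \<in> borel_measurable \<nu>"
    using borel_measurable_continuous_onI[OF assms(3)] assms(2)
    by (simp cong: measurable_cong_sets)
  ultimately show ?thesis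
    by (intro integrable_const_bound[of _ C]) auto
qed

inductive_set trig_polynomials :: "(('i \<Rightarrow> 'a::finite_discrete_ab_group) \<Rightarrow> complex) set" where
  monomial: "\<xi> \<in> product_characters \<Longrightarrow> (\<lambda>x. c * \<xi> x) \<in> trig_polynomials"
| add: "p \<in> trig_polynomials \<Longrightarrow> q \<in> trig_polynomials \<Longrightarrow> (\<lambda>x. p x + q x) \<in> trig_polynomials"

lemma trig_polynomials_mult:
  assumes "p \<in> trig_polynomials" "q \<in> trig_polynomials"
  shows "(\<lambda>x. p x * q x) \<in> trig_polynomials"
  using assms
proof (induction rule: trig_polynomials.induct)
  case (monomial \<xi> c)
  from monomial(2) show ?case
  proof (induction rule: trig_polynomials.induct)
    case (monomial \<xi>' d)
    have "(\<lambda>x. c * \<xi> x * (d * \<xi>' x)) = (\<lambda>x. (c * d) * (\<xi> x * \<xi>' x))"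
      by (simp add: ac_simps)
    then show ?case
      using trig_polynomials.monomial[OF product_characters_mult[OF \<open>\<xi> \<in> _\<close> monomial]] by simp
  next
    case (add p q)
    then show ?case
      using trig_polynomials.add by (simp add: distrib_left)
  qed
next
  case (add p p')
  then show ?case
    using trig_polynomials.add by (simp add: distrib_right)
qed

lemma continuous_trig_polynomial:
  "p \<in> trig_polynomials \<Longrightarrow> continuous_on UNIV p"
  by (induction rule: trig_polynomials.induct)
     (auto intro!: continuous_intros dest: character_product_character simp: character_def)

text \<open>
  The real-valued trigonometric polynomials form an algebra to which Stone--Weierstrass applies: a
  character separating two points has a real or an imaginary part separating them, and both parts
  are trigonometric polynomials because the conjugate of a character is a character.
\<close>
lemma trig_polynomials_dense:
  fixes f :: "('i \<Rightarrow> 'a::finite_discrete_ab_group) \<Rightarrow> real"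
  assumes "continuous_on UNIV f" "0 < \<epsilon>"
  obtains g where "(\<lambda>x. complex_of_real (g x)) \<in> trig_polynomials" and "\<And>x. \<bar>f x - g x\<bar> < \<epsilon>"
proof -
  define P where "P g \<longleftrightarrow> (\<lambda>x :: 'i \<Rightarrow> 'a. complex_of_real (g x)) \<in> trig_polynomials" for g
  have "\<exists>g. P g \<and> (\<forall>x\<in>UNIV. \<bar>f x - g x\<bar> < \<epsilon>)"
  proof (rule Stone_Weierstrass_HOL)
    show "compact (UNIV :: ('i \<Rightarrow> 'a) set)"
      by (rule compact_UNIV_fun)
    show "P (\<lambda>_. c)" for c
      using trig_polynomials.monomial[OF product_characters_one] by (simp add: P_def)
    show "continuous_on UNIV g" if "P g" for g
      using continuous_on_Re[OF continuous_trig_polynomial[OF that[unfolded P_def]]] by simp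
    show "P (\<lambda>x. g x + h x)" if "P g \<and> P h" for g h
      using that trig_polynomials.add unfolding P_def by fastforce
    show "P (\<lambda>x. g x * h x)" if "P g \<and> P h" for g h
      using that trig_polynomials_mult unfolding P_def by fastforce
    show "\<exists>g. P g \<and> g x \<noteq> g y" if "x \<in> UNIV \<and> y \<in> UNIV \<and> x \<noteq> y" for x y
    proof -
      obtain \<xi> where \<xi>: "\<xi> \<in> product_characters" "\<xi> x \<noteq> \<xi> y"
        using product_characters_separate_points \<open>_ \<and> _ \<and> _\<close> by blast
      have "(\<lambda>x. complex_of_real (Re (\<xi> x))) = (\<lambda>x. 1/2 * \<xi> x + 1/2 * cnj (\<xi> x))"
           "(\<lambda>x. complex_of_real (Im (\<xi> x))) = (\<lambda>x. -\<i>/2 * \<xi> x + \<i>/2 * cnj (\<xi> x))"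
        by (auto simp: complex_eq_iff)
      then have "P (\<lambda>x. Re (\<xi> x))" "P (\<lambda>x. Im (\<xi> x))"
        unfolding P_def using \<xi>(1)
        by (simp_all only: trig_polynomials.intros product_characters_cnj)
      with \<xi>(2) show ?thesis
        by (metis complex_eqI)
    qed
  qed (use assms in auto)
  with that show thesis
    unfolding P_def by blast
qed

text \<open>
  By linearity the convergence extends to trigonometric polynomials, and an error \<open>\<epsilon> / 3\<close> in uniform
  approximation costs at most \<open>\<epsilon> / 3\<close> in every integral because all measures are probabilities.
\<close>
lemma weak_star_tendsto_if_product_characters:
  fixes \<nu> :: "nat \<Rightarrow> ('i \<Rightarrow> 'a::finite_discrete_ab_group) measure"
  assumes \<nu>: "\<And>j. prob_space (\<nu> j)" "\<And>j. sets (\<nu> j) = sets borel"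
    and \<eta>: "prob_space \<eta>" "sets \<eta> = sets borel"
    and conv: "\<And>\<xi>. \<xi> \<in> product_characters \<Longrightarrow>
                 ((\<lambda>j. integral\<^sup>L (\<nu> j) \<xi>) \<longlongrightarrow> integral\<^sup>L \<eta> \<xi>) F"
  shows "weak_star_tendsto \<nu> \<eta> F"
  unfolding weak_star_tendsto_def
proof safe
  note integrable_\<nu> = integrable_continuous_fun[OF \<nu>]
  note integrable_\<eta> = integrable_continuous_fun[OF \<eta>]
  have trig: "((\<lambda>j. integral\<^sup>L (\<nu> j) p) \<longlongrightarrow> integral\<^sup>L \<eta> p) F" if "p \<in> trig_polynomials" for p
    using that
  proof (induction rule: trig_polynomials.induct)
    case (monomial \<xi> c)
    then show ?case
      using conv by (simp add: tendsto_mult_left)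
  next
    case (add p q)
    have "integrable (\<nu> j) p" "integrable (\<nu> j) q" "integrable \<eta> p" "integrable \<eta> q" for j
      using add.hyps continuous_trig_polynomial integrable_\<nu> integrable_\<eta> by blast+
    with add.IH show ?case
      by (simp add: tendsto_add)
  qed
  fix f :: "('i \<Rightarrow> 'a) \<Rightarrow> real"
  assume f: "continuous_on UNIV f"
  show "((\<lambda>j. integral\<^sup>L (\<nu> j) f) \<longlongrightarrow> integral\<^sup>L \<eta> f) F"
  proof (rule tendstoI)
    fix \<epsilon> :: real assume "0 < \<epsilon>"
    then have \<epsilon>: "0 < \<epsilon> / 3" by simp
    obtain g where g: "(\<lambda>x. complex_of_real (g x)) \<in> trig_polynomials"
      and fg: "\<And>x. \<bar>f x - g x\<bar> < \<epsilon> / 3"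
      using trig_polynomials_dense[OF f \<epsilon>] by blast
    have cont_g: "continuous_on UNIV g"
      using continuous_on_Re[OF continuous_trig_polynomial[OF g]] by simp
    have close: "\<bar>integral\<^sup>L m f - integral\<^sup>L m g\<bar> \<le> \<epsilon> / 3"
      if m: "prob_space m" "sets m = sets borel" for m
    proof -
      interpret prob_space m by fact
      have int: "integrable m f" "integrable m g"
        using m f cont_g by (auto intro: integrable_continuous_fun)
      then have "\<bar>integral\<^sup>L m f - integral\<^sup>L m g\<bar> = \<bar>\<integral>x. f x - g x \<partial>m\<bar>"
        by simp
      also have "\<dots> \<le> (\<integral>x. \<bar>f x - g x\<bar> \<partial>m)"
        by (rule integral_abs_bound)
      also have "\<dots> \<le> \<epsilon> / 3"
        using int fg by (intro integral_le_const) (auto intro!: AE_I2 less_imp_le)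
      finally show ?thesis .
    qed
    have "((\<lambda>j. integral\<^sup>L (\<nu> j) g) \<longlongrightarrow> integral\<^sup>L \<eta> g) F"
      using trig[OF g] by (simp add: tendsto_of_real_iff)
    then have "\<forall>\<^sub>F j in F. dist (integral\<^sup>L (\<nu> j) g) (integral\<^sup>L \<eta> g) < \<epsilon> / 3"
      using \<epsilon> by (rule tendstoD)
    then show "\<forall>\<^sub>F j in F. dist (integral\<^sup>L (\<nu> j) f) (integral\<^sup>L \<eta> f) < \<epsilon>"
    proof eventually_elim
      case (elim j)
      then show ?case
        using close[OF \<nu>, of j] close[OF \<eta>] unfolding dist_real_def by linarith
    qed
  qed
qed

section \<open>Cellular automata acting on characters\<close>

lemma int_smult_add: "int_smult n (x + y) = int_smult n x + int_smult n y"
  by (simp add: int_smult_def sum.distrib)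

lemma int_smult_fun: "int_smult n (f :: 'i \<Rightarrow> 'a::ab_group_add) = (\<lambda>m. int_smult n (f m))"
proof -
  have "(\<Sum>i<k. f) m = (\<Sum>i<k. f m)" for k :: nat and m
    by (induction k) auto
  then show ?thesis
    by (auto simp: int_smult_def fun_eq_iff)
qed

text \<open>
  Group addition is continuous since \<open>'a\<close> is discrete: a preimage under \<open>f + g\<close> is a union of
  intersections of preimages of points.
\<close>
lemma continuous_on_add_discrete:
  fixes f g :: "'x::topological_space \<Rightarrow> 'a::finite_discrete_ab_group"
  assumes "continuous_on UNIV f" "continuous_on UNIV g"
  shows "continuous_on UNIV (\<lambda>x. f x + g x)"
proof (rule continuous_on_open_vimage[THEN iffD2, rule_format])
  fix B :: "'a set"
  have "open (f -` {u} \<inter> g -` {v})" for u v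
    using assms by (intro open_Int open_vimage) (auto simp: Topological_Spaces.open_discrete)
  then have "open (\<Union>(u, v)\<in>{(u, v). u + v \<in> B}. f -` {u} \<inter> g -` {v})"
    by (intro open_UN) auto
  also have "(\<Union>(u, v)\<in>{(u, v). u + v \<in> B}. f -` {u} \<inter> g -` {v}) = (\<lambda>x. f x + g x) -` B \<inter> UNIV"
    by auto
  finally show "open ((\<lambda>x. f x + g x) -` B \<inter> UNIV)" .
qed simp

lemma linear_cellular_automaton_add:
  assumes "linear_cellular_automaton \<Phi>"
  shows "\<Phi> (a + b) = \<Phi> a + \<Phi> b"
proof -
  obtain F \<phi> where "\<And>a. \<Phi> a = (\<Sum>f\<in>F. int_smult (\<phi> f) (shift f a))"
    using assms unfolding linear_cellular_automaton_def by blast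
  moreover have "shift f (a + b) = shift f a + shift f b" for f
    by (simp add: shift_def fun_eq_iff)
  ultimately show ?thesis
    by (simp only: int_smult_add sum.distrib)
qed

lemma continuous_linear_cellular_automaton:
  fixes \<Phi> :: "('d::finite, 'a::finite_discrete_ab_group) config \<Rightarrow> ('d, 'a) config"
  assumes "linear_cellular_automaton \<Phi>"
  shows "continuous_on UNIV \<Phi>"
proof -
  obtain F \<phi> where F: "finite F" "\<And>a. \<Phi> a = (\<Sum>f\<in>F. int_smult (\<phi> f) (shift f a))"
    using assms unfolding linear_cellular_automaton_def by blast
  have "\<Phi> a m = (\<Sum>f\<in>F. int_smult (\<phi> f) (a (m - f)))" for a m
    unfolding F(2) using F(1) by (induction F) (simp_all add: int_smult_fun shift_def)
  moreover have "continuous_on UNIV (\<lambda>a :: ('d, 'a) config. \<Sum>f\<in>F. int_smult (\<phi> f) (a (m - f)))" for m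
    using F(1)
  proof (induction F)
    case empty
    then show ?case by simp
  next
    case (insert f F)
    have "continuous_on UNIV (\<lambda>a :: ('d, 'a) config. int_smult (\<phi> f) (a (m - f)))"
      by (rule continuous_on_compose2[of UNIV "int_smult (\<phi> f)"]) auto
    with insert show ?case
      by (simp add: continuous_on_add_discrete)
  qed
  ultimately show ?thesis
    by (intro continuous_on_coordinatewise_then_product) simp
qed

lemma character_compose:
  assumes "character \<xi>" "continuous_on UNIV T" "\<And>a b. T (a + b) = T a + T b"
  shows "character (\<xi> \<circ> T)"
  using assms continuous_on_compose2[of UNIV \<xi> UNIV T] by (simp add: character_def o_def)

lemma funpow_continuous_additive:
  fixes T :: "'g::{topological_space, plus} \<Rightarrow> 'g"
  assumes "continuous_on UNIV T" "\<And>a b. T (a + b) = T a + T b"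
  shows "continuous_on UNIV (T ^^ j)" and "(T ^^ j) (a + b) = (T ^^ j) a + (T ^^ j) b"
proof -
  show "continuous_on UNIV (T ^^ j)"
  proof (induction j)
    case (Suc j)
    then show ?case
      using assms(1) by (simp add: o_def) (rule continuous_on_compose2, auto)
  qed (simp add: id_def)
  show "(T ^^ j) (a + b) = (T ^^ j) a + (T ^^ j) b"
    by (induction j) (simp_all add: assms(2))
qed

text \<open>
  For each \<open>n\<close>, mixing fixes a separation \<open>S n\<close> and a rank \<open>R n\<close> beyond which integrals are below
  \<open>1 / (n + 1)\<close>; for each \<open>\<xi>\<close>, dispersion at separation \<open>S n\<close> brings the rank of \<open>\<xi> \<circ> \<Phi>\<^sup>j\<close> above \<open>R n\<close>
  along a set \<open>A n \<xi>\<close> of density one. The set \<open>J\<close> is almost contained in each of these countably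
  many sets.
\<close>
lemma density_one_integrals_tendsto_0:
  fixes \<Phi> :: "('d::finite, 'a::finite_discrete_ab_group) config \<Rightarrow> ('d, 'a) config"
  assumes lca: "linear_cellular_automaton \<Phi>" and "dispersive \<Phi>" and "dispersion_mixing \<mu>"
    and \<Xi>: "countable \<Xi>" "\<And>\<xi>. \<xi> \<in> \<Xi> \<Longrightarrow> nontrivial_character \<xi>"
  obtains J where "density_one J"
    and "\<And>\<xi>. \<xi> \<in> \<Xi> \<Longrightarrow> ((\<lambda>j. integral\<^sup>L \<mu> (\<xi> \<circ> (\<Phi> ^^ j))) \<longlongrightarrow> 0) (sequentially_in J)"
proof -
  have "\<exists>S>0. \<exists>R>0. \<forall>\<xi>. character \<xi> \<and> real (char_rank S \<xi>) > R \<longrightarrow>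
          norm (integral\<^sup>L \<mu> \<xi>) < inverse (real (Suc n))" for n
    using assms(3) unfolding dispersion_mixing_def by simp
  then obtain S R where S: "\<And>n. S n > 0"
    and mixing: "\<And>n \<xi>. character \<xi> \<Longrightarrow> real (char_rank (S n) \<xi>) > R n \<Longrightarrow>
                   norm (integral\<^sup>L \<mu> \<xi>) < inverse (real (Suc n))"
    by metis
  define disperses where "disperses n \<xi> J \<longleftrightarrow> density_one J \<and>
      filterlim (\<lambda>j. char_rank (S n) (\<xi> \<circ> (\<Phi> ^^ j))) at_top (sequentially_in J)" for n \<xi> J
  define A where "A n \<xi> = (SOME J. disperses n \<xi> J)" for n \<xi>
  have "disperses n \<xi> (A n \<xi>)" if "\<xi> \<in> \<Xi>" for n \<xi>
  proof -
    have "\<exists>J. disperses n \<xi> J"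
      using \<open>dispersive \<Phi>\<close> S \<Xi>(2)[OF that] unfolding dispersive_def disperses_def by blast
    then show ?thesis
      unfolding A_def by (rule someI_ex)
  qed
  then have A: "\<And>n \<xi>. \<xi> \<in> \<Xi> \<Longrightarrow> density_one (A n \<xi>)"
    and rank: "\<And>n \<xi>. \<xi> \<in> \<Xi> \<Longrightarrow>
      filterlim (\<lambda>j. char_rank (S n) (\<xi> \<circ> (\<Phi> ^^ j))) at_top (sequentially_in (A n \<xi>))"
    by (simp_all add: disperses_def)
  obtain J where J: "density_one J" "\<And>n \<xi>. \<xi> \<in> \<Xi> \<Longrightarrow> finite (J - A n \<xi>)"
  proof (cases "\<Xi> = {}")
    case True
    have "density_one UNIV"
      unfolding density_one_def by (rule tendsto_eventually) (auto intro: eventually_sequentiallyI[of 1])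
    with True that show ?thesis
      by blast
  next
    case False
    define B where "B k = (case prod_decode k of (n, i) \<Rightarrow> A n (from_nat_into \<Xi> i))" for k
    have "density_one (B k)" for k
      using A from_nat_into[OF False] by (simp add: B_def split: prod.split)
    then obtain J where J: "density_one J" "\<And>k. finite (J - B k)"
      using density_one_pseudo_intersection by blast
    have "finite (J - A n \<xi>)" if "\<xi> \<in> \<Xi>" for n \<xi>
    proof -
      have "A n \<xi> = B (prod_encode (n, to_nat_on \<Xi> \<xi>))"
        using \<Xi>(1) that by (simp add: B_def)
      with J(2) show ?thesis by simp
    qed
    with J(1) that show ?thesis
      by blast
  qed
  have "((\<lambda>j. integral\<^sup>L \<mu> (\<xi> \<circ> (\<Phi> ^^ j))) \<longlongrightarrow> 0) (sequentially_in J)" if \<xi>: "\<xi> \<in> \<Xi>" for \<xi>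
  proof (rule tendstoI)
    fix \<epsilon> :: real assume "0 < \<epsilon>"
    then obtain n where n: "inverse (real (Suc n)) < \<epsilon>"
      using reals_Archimedean[of \<epsilon>] by auto
    have "filterlim (\<lambda>j. char_rank (S n) (\<xi> \<circ> (\<Phi> ^^ j))) at_top (sequentially_in J)"
      by (rule filterlim_mono[OF rank[OF \<xi>] order_refl sequentially_in_mono[OF J(2)[OF \<xi>]]])
    then have "\<forall>\<^sub>F j in sequentially_in J. Suc (nat \<lceil>R n\<rceil>) \<le> char_rank (S n) (\<xi> \<circ> (\<Phi> ^^ j))"
      unfolding filterlim_at_top by blast
    then show "\<forall>\<^sub>F j in sequentially_in J. dist (integral\<^sup>L \<mu> (\<xi> \<circ> (\<Phi> ^^ j))) 0 < \<epsilon>"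
    proof eventually_elim
      case (elim j)
      have "character (\<xi> \<circ> (\<Phi> ^^ j))"
        using \<Xi>(2)[OF \<xi>] continuous_linear_cellular_automaton[OF lca]
          linear_cellular_automaton_add[OF lca]
        by (intro character_compose funpow_continuous_additive) (auto simp: nontrivial_character_def)
      moreover have "R n < real (char_rank (S n) (\<xi> \<circ> (\<Phi> ^^ j)))"
        using elim by linarith
      ultimately show ?case
        using mixing n by (fastforce simp: dist_norm)
    qed
  qed
  with J(1) show thesis
    by (rule that)
qed

theorem theorem3p1:
  fixes \<Phi> :: "('d::finite, 'a::finite_discrete_ab_group) config \<Rightarrow> ('d, 'a) config"
    and \<mu> :: "('d, 'a) config measure"
  assumes "linear_cellular_automaton \<Phi>" and "dispersive \<Phi>"
    and "prob_space \<mu>" and "sets \<mu> = sets borel" and "dispersion_mixing \<mu>"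
  shows "asymptotically_randomizes \<Phi> \<mu>"
proof -
  let ?\<Xi> = "product_characters - {\<lambda>_. 1} :: (('d, 'a) config \<Rightarrow> complex) set"
  have "countable ?\<Xi>"
    by (intro countable_Diff countable_product_characters)
  moreover have "nontrivial_character \<xi>" if "\<xi> \<in> ?\<Xi>" for \<xi>
    using that by (simp add: nontrivial_character_def character_product_character)
  ultimately obtain J where J: "density_one J"
    and lim: "\<And>\<xi>. \<xi> \<in> ?\<Xi> \<Longrightarrow>
                ((\<lambda>j. integral\<^sup>L \<mu> (\<xi> \<circ> (\<Phi> ^^ j))) \<longlongrightarrow> 0) (sequentially_in J)"
    using density_one_integrals_tendsto_0[OF assms(1,2,5)] by blast
  have meas: "\<Phi> ^^ j \<in> measurable \<mu> borel" for j
  proof -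
    have "continuous_on UNIV (\<Phi> ^^ j)"
      using continuous_linear_cellular_automaton linear_cellular_automaton_add assms(1)
      by (intro funpow_continuous_additive)
    then show ?thesis
      using assms(4) borel_measurable_continuous_onI by (simp cong: measurable_cong_sets)
  qed
  have "weak_star_tendsto (\<lambda>j. distr \<mu> borel (\<Phi> ^^ j)) uniform_bernoulli (sequentially_in J)"
  proof (rule weak_star_tendsto_if_product_characters)
    show "prob_space (distr \<mu> borel (\<Phi> ^^ j))" for j
      using assms(3) meas by (rule prob_space.prob_space_distr)
    fix \<xi> :: "('d, 'a) config \<Rightarrow> complex"
    assume \<xi>: "\<xi> \<in> product_characters"
    show "((\<lambda>j. integral\<^sup>L (distr \<mu> borel (\<Phi> ^^ j)) \<xi>) \<longlongrightarrow> integral\<^sup>L uniform_bernoulli \<xi>)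
            (sequentially_in J)"
    proof (cases "\<xi> = (\<lambda>_. 1)")
      case True
      interpret \<mu>: prob_space \<mu> by fact
      interpret \<eta>: prob_space "uniform_bernoulli :: ('d, 'a) config measure"
        by (rule prob_space_uniform_bernoulli)
      have "measure (distr \<mu> borel (\<Phi> ^^ j)) (space (distr \<mu> borel (\<Phi> ^^ j))) = 1" for j
        using meas by (intro prob_space.prob_space \<mu>.prob_space_distr)
      then show ?thesis
        using True \<eta>.prob_space by simp
    next
      case False
      have "\<xi> \<in> borel_measurable borel"
        using character_product_character[OF \<xi>]
        by (intro borel_measurable_continuous_onI) (simp add: character_def)
      then have "integral\<^sup>L (distr \<mu> borel (\<Phi> ^^ j)) \<xi> = integral\<^sup>L \<mu> (\<xi> \<circ> (\<Phi> ^^ j))" for j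
        using integral_distr[OF meas] by (simp add: o_def)
      then show ?thesis
        using lim \<xi> False by (simp add: integral_uniform_bernoulli_product_character)
    qed
  qed (simp_all add: sets_uniform_bernoulli prob_space_uniform_bernoulli)
  with J show ?thesis
    unfolding asymptotically_randomizes_def by blast
qed

end
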